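(* On six qubits let $|\Psi\rangle_6=\tfrac{1}{\sqrt2}(|0\rangle_6+|\overline{\mathrm{D}}\rangle_6)$ with $|\overline{\mathrm{D}}\rangle_6=\tfrac13\sum_{\{i,j\}\in P}|ij\rangle_6$, $P=\{\{1,3\},\{1,4\},\{1,5\},\{2,4\},\{2,5\},\{2,6\},\{3,5\},\{3,6\},\{4,6\}\}$. Let $\mathcal{G}_6$ be the group of unitaries on $(\mathbb{C}^2)^{\otimes6}$ generated by the cyclic qubit permutation $P_c$ (mapping the qubit order $(123456)\mapsto(234561)$) and the reflection $R$ (mapping $(123456)\mapsto(654321)$). Then there is no Hermitian operator $\overline{H}$ on $(\mathbb{C}^2)^{\otimes6}$ of the form $\overline{H}=\sum_{\{i,j\}}\overline{H}_{\{i,j\}}\otimes I_{\text{rest}}$ (sum over two-element subsets $\{i,j\}\subset\{1,\dots,6\}$, each $\overline{H}_{\{i,j\}}$ acting on qubits $i,j$) satisfying $G^\dagger\overline{H}G=\overline{H}$ for all $G\in\mathcal{G}_6$ and having $|\Psi\rangle_6$ as its unique ground state.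
   Context: $|0\rangle_6=|0\rangle^{\otimes6}$ and $|ij\rangle_6$ is the computational basis state with qubits $i,j$ in $|1\rangle$ and all others in $|0\rangle$. Qubit permutations act as unitaries permuting tensor factors. A Hermitian operator has $|\psi\rangle$ as its unique ground state if the eigenspace of its smallest eigenvalue is $\mathrm{span}\{|\psi\rangle\}$. *)

theory Defs
  imports "Jordan_Normal_Form.Schur_Decomposition" "Jordan_Normal_Form.Char_Poly"
begin

text \<open>Six qubits, labelled 1..6. The computational basis state with qubit i (1-based)
  having value b_i is the index k < 64 whose bit (i-1) is b_i.\<close>

definition qb :: "nat \<Rightarrow> nat \<Rightarrow> bool" where
  "qb q k = odd (k div 2 ^ q)"   (* value of qubit q+1 in basis index k *)

definition ket_ij :: "nat \<Rightarrow> nat \<Rightarrow> nat" where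
  "ket_ij i j = 2 ^ (i - 1) + 2 ^ (j - 1)"   (* index of |ij>_6, qubits i,j 1-based *)

definition pairsP :: "(nat \<times> nat) set" where
  "pairsP = {(1,3),(1,4),(1,5),(2,4),(2,5),(2,6),(3,5),(3,6),(4,6)}"

definition psi6 :: "complex vec" where
  "psi6 = vec 64 (\<lambda>k. (if k = 0 then 1 else 0) / complex_of_real (sqrt 2)
      + (if \<exists>(i,j)\<in>pairsP. k = ket_ij i j then 1 / 3 else 0) / complex_of_real (sqrt 2))"

text \<open>Qubit permutation unitaries: P_c maps |x1..x6> to |x2 x3 x4 x5 x6 x1>,
  R maps |x1..x6> to |x6 x5 x4 x3 x2 x1>.\<close>

definition Pc :: "complex mat" where
  "Pc = mat 64 64 (\<lambda>(k,l). if \<forall>q<6. qb q k = qb ((q + 1) mod 6) l then 1 else 0)"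

definition Rf :: "complex mat" where
  "Rf = mat 64 64 (\<lambda>(k,l). if \<forall>q<6. qb q k = qb (5 - q) l then 1 else 0)"

inductive_set G6 :: "complex mat set" where
  id: "1\<^sub>m 64 \<in> G6"
| pc: "G \<in> G6 \<Longrightarrow> Pc * G \<in> G6"
| rf: "G \<in> G6 \<Longrightarrow> Rf * G \<in> G6"
| pc_inv: "G \<in> G6 \<Longrightarrow> mat_adjoint Pc * G \<in> G6"
| rf_inv: "G \<in> G6 \<Longrightarrow> mat_adjoint Rf * G \<in> G6"

text \<open>Embedding h \<otimes> I_rest of a two-qubit operator h (4x4, basis |b_i b_j>, index
  2 b_i + b_j) acting on qubits i+1 and j+1 (0-based i, j).\<close>

definition idx2 :: "nat \<Rightarrow> nat \<Rightarrow> nat \<Rightarrow> nat" where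
  "idx2 i j k = 2 * of_bool (qb i k) + of_bool (qb j k)"

definition embed2 :: "nat \<Rightarrow> nat \<Rightarrow> complex mat \<Rightarrow> complex mat" where
  "embed2 i j h = mat 64 64 (\<lambda>(k,l).
     if \<forall>q<6. q \<noteq> i \<and> q \<noteq> j \<longrightarrow> qb q k = qb q l then h $$ (idx2 i j k, idx2 i j l) else 0)"

definition two_local_sum :: "(nat \<Rightarrow> nat \<Rightarrow> complex mat) \<Rightarrow> complex mat" where
  "two_local_sum h = mat 64 64 (\<lambda>(k,l).
     \<Sum>(i,j)\<in>{(i,j). i < j \<and> j < 6}. embed2 i j (h i j) $$ (k,l))"

definition hermitian_mat :: "complex mat \<Rightarrow> bool" where
  "hermitian_mat A \<longleftrightarrow> A \<in> carrier_mat (dim_row A) (dim_row A) \<and> mat_adjoint A = A"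

definition unique_ground_state :: "complex mat \<Rightarrow> complex vec \<Rightarrow> bool" where
  "unique_ground_state H psi \<longleftrightarrow>
     (\<exists>lam. eigenvalue H lam \<and> (\<forall>mu. eigenvalue H mu \<longrightarrow> Re lam \<le> Re mu) \<and>
        {v \<in> carrier_vec (dim_row H). H *\<^sub>v v = lam \<cdot>\<^sub>v v} = {c \<cdot>\<^sub>v psi | c. True})"

end

theory Submission
  imports Defs
begin

text \<open>
  Write \<open>H psi = lam psi\<close> row by row, grading basis states by the number of qubits in state 1.
  Rotation invariance leaves one amplitude for creating a pair out of the vacuum per cyclic distance
  1, 2, 3, and the rows of weight 4 give a nonsingular homogeneous system for these three amplitudes.
  An amplitude creating a single qubit is affine in the occupations of the others; the rows of
  weight 3 determine its slopes from its value \<open>a\<close> at the vacuum, and the row of weight 1 then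
  becomes \<open>6 a + 3 cnj a = 0\<close>, so \<open>a = 0\<close>. Hence the vacuum is itself an eigenvector, and the row of
  weight 0 shows that its eigenvalue is \<open>lam\<close> too, so the eigenspace of \<open>lam\<close> is not spanned by \<open>psi\<close>.
\<close>

section \<open>Matrix entries of two-local operators\<close>

lemma all_less_6: "(\<forall>q<6. P q) \<longleftrightarrow> P 0 \<and> P 1 \<and> P 2 \<and> P 3 \<and> P 4 \<and> P (5::nat)"
  by (simp add: eval_nat_numeral All_less_Suc) blast

lemma ordered_pairs_6:
  "{(i, j). i < j \<and> j < 6} =
    {(0,1),(0,2),(1,2),(0,3),(1,3),(2,3),(0,4),(1,4),(2,4),(3,4),(0,5),(1,5),(2,5),(3,5),(4,5::nat)}"
proof -
  have "{(i, j). i < j \<and> j < 6} = set (concat (map (\<lambda>j. map (\<lambda>i. (i, j)) [0..<j]) [0..<6]))"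
    by auto
  then show ?thesis by (simp add: upt_rec numeral_eq_Suc)
qed

text \<open>The entry of \<open>embed2 i j (h i j)\<close> at \<open>(k, l)\<close>, freed from its
  matrix so that the simplifier can evaluate it at numerals.\<close>

definition pair_term :: "(nat \<Rightarrow> nat \<Rightarrow> complex mat) \<Rightarrow> nat \<Rightarrow> nat \<Rightarrow> nat \<Rightarrow> nat \<Rightarrow> complex" where
  "pair_term h k l i j =
     (if \<forall>q<6. q \<noteq> i \<and> q \<noteq> j \<longrightarrow> qb q k = qb q l then h i j $$ (idx2 i j k, idx2 i j l) else 0)"

lemma two_local_sum_eq_sum_pair_term:
  assumes "k < 64" "l < 64"
  shows "two_local_sum h $$ (k, l) = (\<Sum>(i, j)\<in>{(i, j). i < j \<and> j < 6}. pair_term h k l i j)"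
  using assms by (simp add: two_local_sum_def embed2_def pair_term_def)

lemma two_local_sum_entry:
  assumes "k < 64" "l < 64"
  shows "two_local_sum h $$ (k, l) =
    pair_term h k l 0 1 + pair_term h k l 0 2 + pair_term h k l 1 2 + pair_term h k l 0 3 +
    pair_term h k l 1 3 + pair_term h k l 2 3 + pair_term h k l 0 4 + pair_term h k l 1 4 +
    pair_term h k l 2 4 + pair_term h k l 3 4 + pair_term h k l 0 5 + pair_term h k l 1 5 +
    pair_term h k l 2 5 + pair_term h k l 3 5 + pair_term h k l 4 5"
  unfolding two_local_sum_eq_sum_pair_term[OF assms] ordered_pairs_6 by (simp add: add.assoc)

section \<open>The cyclic rotation on basis indices\<close>

definition rot6 :: "nat \<Rightarrow> nat" where
  "rot6 l = l div 2 + 32 * (l mod 2)"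

lemma rot6_less: "l < 64 \<Longrightarrow> rot6 l < 64"
  unfolding rot6_def by linarith

lemma eq_if_qb_eq:
  assumes "k < 64" "l < 64" and "\<forall>q<6. qb q k = qb q l"
  shows "k = l"
proof (rule bit_eqI)
  fix n
  show "bit k n = bit l n"
  proof (cases "n < 6")
    case True
    then show ?thesis using assms(3) by (simp add: qb_def bit_iff_odd)
  next
    case False
    then have "(2::nat) ^ 6 \<le> 2 ^ n" by (intro power_increasing) auto
    then have "k < 2 ^ n" "l < 2 ^ n" using assms(1,2) by simp_all
    then show ?thesis by (simp add: bit_iff_odd)
  qed
qed

lemma eq_if_qb_supported_on_pair:
  assumes k: "k < 64" and ij: "i < j" "j < 6"
    and off: "\<forall>q<6. q \<noteq> i \<and> q \<noteq> j \<longrightarrow> \<not> qb q k"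
  shows "k = of_bool (qb i k) * 2 ^ i + of_bool (qb j k) * 2 ^ j"
proof -
  define m where "m = of_bool (qb i k) * 2 ^ i + of_bool (qb j k) * (2::nat) ^ j"
  have "(i, j) \<in> {(i, j). i < j \<and> j < 6}"
    using ij by simp
  then have "m < 64 \<and> (\<forall>q<6. qb q k = qb q m)"
    using off unfolding ordered_pairs_6 all_less_6 m_def
    by (elim insertE emptyE; cases "qb i k"; cases "qb j k"; simp add: qb_def)
  then show ?thesis
    using k unfolding m_def by (intro eq_if_qb_eq) auto
qed

text \<open>Halving shifts the upper five bits down, and the lowest bit reappears at position 5: the
  index action of \<open>Pc\<close>.\<close>

lemma qb_rot6:
  assumes "l < 64" "q < 6"
  shows "qb q (rot6 l) = qb ((q + 1) mod 6) l"
proof (cases "q = 5")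
  case True
  have "rot6 l div 32 = l mod 2"
    using assms(1) unfolding rot6_def by linarith
  then show ?thesis
    using True by (simp add: qb_def odd_iff_mod_2_eq_one)
next
  case False
  then have q: "q < 5" using assms(2) by simp
  \<comment> \<open>After a shift by \<open>q < 5\<close> the wrapped bit still carries an even
    factor, so it does not affect the parity.\<close>
  have "(2::nat) ^ 5 = 2 ^ q * 2 ^ (5 - q)"
    using q by (simp flip: power_add)
  then have "rot6 l = l div 2 + 2 ^ q * (2 ^ (5 - q) * (l mod 2))"
    by (simp add: rot6_def)
  then have "rot6 l div 2 ^ q = l div 2 ^ (q + 1) + 2 ^ (5 - q) * (l mod 2)"
    by (simp add: div_mult2_eq add.commute)
  moreover have "even ((2::nat) ^ (5 - q))"
    using q by simp
  ultimately show ?thesis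
    using q by (simp add: qb_def)
qed

lemma Pc_eq_rot6: "Pc = mat 64 64 (\<lambda>(k, l). if k = rot6 l then 1 else 0)"
  unfolding Pc_def
  by (rule eq_matI) (auto simp: qb_rot6 intro: eq_if_qb_eq rot6_less)

text \<open>\<open>Pc\<close> is a real permutation matrix: column \<open>m\<close> of
  \<open>Pc\<close> and row \<open>m\<close> of its adjoint are both the unit vector at
  \<open>rot6 m\<close>.\<close>

lemma Pc_conjugate_entry:
  assumes H: "H \<in> carrier_mat 64 64" and kl: "k < 64" "l < 64"
  shows "(mat_adjoint Pc * H * Pc) $$ (k, l) = H $$ (rot6 k, rot6 l)"
proof -
  have col: "col Pc m = unit_vec 64 (rot6 m)" if "m < 64" for m
    using that by (auto simp: Pc_eq_rot6 unit_vec_def)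
  have Pc: "Pc \<in> carrier_mat 64 64" by (simp add: Pc_def)
  have row: "row (mat_adjoint Pc) k = unit_vec 64 (rot6 k)"
    using kl Pc by (auto simp: mat_adjoint_def col unit_vec_def conjugate_vec_def)
  have ad: "mat_adjoint Pc \<in> carrier_mat 64 64"
    using Pc by (intro carrier_matI) (auto simp: mat_adjoint_def)
  have "(mat_adjoint Pc * H * Pc) $$ (k, l) = (mat_adjoint Pc * (H * Pc)) $$ (k, l)"
    using H Pc ad by (simp add: assoc_mult_mat[of _ 64 64 _ 64 _ 64])
  also have "\<dots> = unit_vec 64 (rot6 k) \<bullet> col (H * Pc) l"
    using kl H Pc ad by (subst index_mult_mat) (auto simp: row)
  also have "\<dots> = (H * Pc) $$ (rot6 k, l)"
    using kl H Pc rot6_less[of k] by (subst scalar_prod_left_unit) auto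
  also have "\<dots> = row H (rot6 k) \<bullet> unit_vec 64 (rot6 l)"
    using kl H Pc rot6_less[of k] by (subst index_mult_mat) (auto simp: col)
  also have "\<dots> = H $$ (rot6 k, rot6 l)"
    using kl H rot6_less[of k] rot6_less[of l] by (subst scalar_prod_right_unit) auto
  finally show ?thesis .
qed

section \<open>Rows of the eigenvalue equation\<close>

text \<open>The nine indices below are those of the states \<open>|ij>\<close> with \<open>{i,j}\<close> in \<open>P\<close>.\<close>

lemma psi6_eq:
  "psi6 = vec 64 (\<lambda>k. (if k = 0 then 3 else if k \<in> {5,9,17,10,18,34,20,36,40} then 1 else 0)
     / (3 * complex_of_real (sqrt 2)))"
  unfolding psi6_def pairsP_def ket_ij_def by (rule eq_vecI) auto

lemma psi6_row:
  assumes H: "H \<in> carrier_mat 64 64" and eig: "H *\<^sub>v psi6 = lam \<cdot>\<^sub>v psi6" and k: "k < 64"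
  shows "3 * H $$ (k,0) + H $$ (k,5) + H $$ (k,9) + H $$ (k,17) + H $$ (k,10) + H $$ (k,18)
      + H $$ (k,34) + H $$ (k,20) + H $$ (k,36) + H $$ (k,40)
    = lam * (if k = 0 then 3 else if k \<in> {5,9,17,10,18,34,20,36,40} then 1 else 0)"
proof -
  define c where "c = 3 * complex_of_real (sqrt 2)"
  define w :: "nat \<Rightarrow> complex" where
    "w k = (if k = 0 then 3 else if k \<in> {5,9,17,10,18,34,20,36,40} then 1 else 0)" for k
  have c: "c \<noteq> 0" by (simp add: c_def)
  have psi: "psi6 = vec 64 (\<lambda>k. w k / c)" by (simp add: psi6_eq w_def c_def)
  have "(H *\<^sub>v psi6) $ k = (\<Sum>l\<in>{0..<64}. H $$ (k, l) * (w l / c))"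
    using H k by (simp add: psi scalar_prod_def)
  also have "\<dots> = (\<Sum>l\<in>{0..<64}. H $$ (k, l) * w l) / c"
    by (simp add: sum_divide_distrib)
  also have "(\<Sum>l\<in>{0..<64}. H $$ (k, l) * w l) =
      (\<Sum>l\<in>{0,5,9,17,10,18,34,20,36,40}. H $$ (k, l) * w l)"
    by (rule sum.mono_neutral_right) (auto simp: w_def)
  finally have "(\<Sum>l\<in>{0,5,9,17,10,18,34,20,36,40}. H $$ (k, l) * w l) = lam * w k"
    using c k eig by (simp add: psi)
  then show ?thesis by (simp add: w_def add.assoc mult.commute)
qed

text \<open>The coefficient matrix has determinant -8.\<close>

lemma weight_4_rows_trivial:
  fixes x y z :: complex
  assumes "x + 2 * y = 0" "2 * x + y + z = 0" "2 * y + 2 * z = 0"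
  shows "x = 0" "y = 0" "z = 0"
  using assms by (simp_all add: complex_eq_iff)

text \<open>Here \<open>a\<close> creates qubit 1 from the vacuum, and \<open>p\<close>,
  \<open>q\<close>, \<open>t\<close>, \<open>s\<close>, \<open>r\<close> create it when only qubit
  2, 3, 4, 5, 6 is occupied. The first four equations force
  \<open>q = s = t = a / 2\<close>.\<close>

lemma odd_rows_trivial:
  fixes a p q r s t :: complex
  assumes "p + r = a" "q + s = a" "r + q + p + t = 2 * a" "r + s + p + t = 2 * a"
    and "3 * a + cnj (s + t + q) = 0"
  shows "a = 0"
proof -
  have half: "2 * Re s = Re a" "2 * Re t = Re a" "2 * Re q = Re a"
    "2 * Im s = Im a" "2 * Im t = Im a" "2 * Im q = Im a"
    using assms(1-4) by (simp_all add: complex_eq_iff)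
  have sum: "3 * Re a + (Re s + Re t + Re q) = 0" "3 * Im a = Im s + Im t + Im q"
    using assms(5) by (simp_all add: complex_eq_iff)
  have "Re a = 0" using half sum by linarith
  moreover have "Im a = 0" using half sum by linarith
  ultimately show ?thesis by (simp add: complex_eq_iff)
qed

section \<open>Vanishing of the creation amplitudes\<close>

locale cyclic_two_local_psi6 =
  fixes H :: "complex mat" and h :: "nat \<Rightarrow> nat \<Rightarrow> complex mat" and lam :: complex
  assumes H_eq: "H = two_local_sum h"
    and adjoint: "mat_adjoint H = H"
    and rotate: "\<And>k l. k < 64 \<Longrightarrow> l < 64 \<Longrightarrow> H $$ (k, l) = H $$ (rot6 k, rot6 l)"
    and eigen: "H *\<^sub>v psi6 = lam \<cdot>\<^sub>v psi6"
begin

lemma carrier: "H \<in> carrier_mat 64 64"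
  by (simp add: H_eq two_local_sum_def)

lemmas row_eq = psi6_row[OF carrier eigen]

lemma entry_cnj: "k < 64 \<Longrightarrow> l < 64 \<Longrightarrow> H $$ (k, l) = cnj (H $$ (l, k))"
  using carrier arg_cong[OF adjoint, of "\<lambda>A. A $$ (k, l)"]
  by (simp add: mat_adjoint_def mat_of_rows_index)

text \<open>The set lists the pair states by cyclic distance 1, 2, 3; rows 15, 58, 54 are the states of
  weight 4 whose two empty qubits have cyclic distance 1, 2, 3.\<close>

lemma pair_creation_eq_0:
  assumes "k \<in> {3,6,12,24,48,33, 5,10,20,40,17,34, 9,18,36}"
  shows "H $$ (k, 0) = 0"
proof -
  have orbits:
    "H $$ (6, 0) = H $$ (3, 0)" "H $$ (12, 0) = H $$ (3, 0)" "H $$ (24, 0) = H $$ (3, 0)"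
    "H $$ (48, 0) = H $$ (3, 0)" "H $$ (33, 0) = H $$ (3, 0)" "H $$ (10, 0) = H $$ (5, 0)"
    "H $$ (20, 0) = H $$ (5, 0)" "H $$ (40, 0) = H $$ (5, 0)" "H $$ (17, 0) = H $$ (5, 0)"
    "H $$ (34, 0) = H $$ (5, 0)" "H $$ (18, 0) = H $$ (9, 0)" "H $$ (36, 0) = H $$ (9, 0)"
    using rotate[of 6 0] rotate[of 12 0] rotate[of 24 0] rotate[of 48 0] rotate[of 33 0]
      rotate[of 10 0] rotate[of 20 0] rotate[of 40 0] rotate[of 17 0] rotate[of 34 0]
      rotate[of 18 0] rotate[of 36 0]
    by (simp_all add: rot6_def)
  \<comment> \<open>These states differ from 15 in four qubits, and a two-qubit term changes at most
    two.\<close>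
  have zero_15:
    "H $$ (15, 0) = 0" "H $$ (15, 17) = 0" "H $$ (15, 18) = 0" "H $$ (15, 34) = 0"
    "H $$ (15, 20) = 0" "H $$ (15, 36) = 0" "H $$ (15, 40) = 0"
    by (simp_all add: H_eq two_local_sum_entry pair_term_def all_less_6 qb_def idx2_def)
  \<comment> \<open>When exactly two qubits change, only the term on that pair contributes, and it
    does not see the other qubits. The entry is thus a vacuum amplitude.\<close>
  have create_15:
    "H $$ (15, 5) = H $$ (10, 0)" "H $$ (15, 9) = H $$ (6, 0)" "H $$ (15, 10) = H $$ (5, 0)"
    by (simp_all add: H_eq two_local_sum_entry pair_term_def all_less_6 qb_def idx2_def)
  have zero_58:
    "H $$ (58, 0) = 0" "H $$ (58, 5) = 0" "H $$ (58, 9) = 0" "H $$ (58, 17) = 0"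
    "H $$ (58, 20) = 0" "H $$ (58, 36) = 0"
    by (simp_all add: H_eq two_local_sum_entry pair_term_def all_less_6 qb_def idx2_def)
  have create_58:
    "H $$ (58, 10) = H $$ (48, 0)" "H $$ (58, 18) = H $$ (40, 0)"
    "H $$ (58, 34) = H $$ (24, 0)" "H $$ (58, 40) = H $$ (18, 0)"
    by (simp_all add: H_eq two_local_sum_entry pair_term_def all_less_6 qb_def idx2_def)
  have zero_54:
    "H $$ (54, 0) = 0" "H $$ (54, 5) = 0" "H $$ (54, 9) = 0" "H $$ (54, 17) = 0"
    "H $$ (54, 10) = 0" "H $$ (54, 40) = 0"
    by (simp_all add: H_eq two_local_sum_entry pair_term_def all_less_6 qb_def idx2_def)
  have create_54:
    "H $$ (54, 18) = H $$ (36, 0)" "H $$ (54, 34) = H $$ (20, 0)"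
    "H $$ (54, 20) = H $$ (34, 0)" "H $$ (54, 36) = H $$ (18, 0)"
    by (simp_all add: H_eq two_local_sum_entry pair_term_def all_less_6 qb_def idx2_def)
  have "H $$ (3, 0) + 2 * H $$ (5, 0) = 0"
    using row_eq[of 15] by (simp add: zero_15 create_15 orbits add.commute)
  moreover have "2 * H $$ (3, 0) + H $$ (5, 0) + H $$ (9, 0) = 0"
    using row_eq[of 58] by (simp add: zero_58 create_58 orbits)
  moreover have "2 * H $$ (5, 0) + 2 * H $$ (9, 0) = 0"
    using row_eq[of 54] by (simp add: zero_54 create_54 orbits add.commute)
  ultimately have "H $$ (3, 0) = 0" "H $$ (5, 0) = 0" "H $$ (9, 0) = 0"
    by (rule weight_4_rows_trivial)+
  then show ?thesis
    using assms orbits by auto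
qed

lemma single_creation_eq_0:
  assumes "k \<in> {1,2,4,8,16,32}"
  shows "H $$ (k, 0) = 0"
proof -
  have orbit:
    "H $$ (2, 0) = H $$ (1, 0)" "H $$ (4, 0) = H $$ (1, 0)" "H $$ (8, 0) = H $$ (1, 0)"
    "H $$ (16, 0) = H $$ (1, 0)" "H $$ (32, 0) = H $$ (1, 0)"
    using rotate[of 2 0] rotate[of 4 0] rotate[of 8 0] rotate[of 16 0] rotate[of 32 0]
    by (simp_all add: rot6_def)
  \<comment> \<open>Rows 7, 21, 11, 13 represent the four rotation orbits of weight 3. An entry can
    survive only where the column arises by emptying one occupied qubit.\<close>
  have zero_7:
    "H $$ (7, 0) = 0" "H $$ (7, 9) = 0" "H $$ (7, 17) = 0" "H $$ (7, 10) = 0"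
    "H $$ (7, 18) = 0" "H $$ (7, 34) = 0" "H $$ (7, 20) = 0" "H $$ (7, 36) = 0"
    "H $$ (7, 40) = 0"
    by (simp_all add: H_eq two_local_sum_entry pair_term_def all_less_6 qb_def idx2_def)
  \<comment> \<open>Rotation makes qubit 1 the created one, here and for the other rows.\<close>
  have rot_7:
    "H $$ (7, 5) = H $$ (35, 34)"
    using rotate[of 7 5]
    by (simp_all add: rot6_def)
  have zero_21:
    "H $$ (21, 0) = 0" "H $$ (21, 9) = 0" "H $$ (21, 10) = 0" "H $$ (21, 18) = 0"
    "H $$ (21, 34) = 0" "H $$ (21, 36) = 0" "H $$ (21, 40) = 0"
    by (simp_all add: H_eq two_local_sum_entry pair_term_def all_less_6 qb_def idx2_def)
  have rot_21:
    "H $$ (21, 5) = H $$ (21, 20)" "H $$ (21, 17) = H $$ (21, 20)"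
    using rotate[of 21 5] rotate[of 42 34] rotate[of 21 17] rotate[of 42 40]
    by (simp_all add: rot6_def)
  have zero_11:
    "H $$ (11, 0) = 0" "H $$ (11, 5) = 0" "H $$ (11, 17) = 0" "H $$ (11, 18) = 0"
    "H $$ (11, 34) = 0" "H $$ (11, 20) = 0" "H $$ (11, 36) = 0" "H $$ (11, 40) = 0"
    by (simp_all add: H_eq two_local_sum_entry pair_term_def all_less_6 qb_def idx2_def)
  have rot_11:
    "H $$ (11, 9) = H $$ (37, 36)"
    using rotate[of 11 9]
    by (simp_all add: rot6_def)
  have zero_13:
    "H $$ (13, 0) = 0" "H $$ (13, 17) = 0" "H $$ (13, 10) = 0" "H $$ (13, 18) = 0"
    "H $$ (13, 34) = 0" "H $$ (13, 20) = 0" "H $$ (13, 36) = 0" "H $$ (13, 40) = 0"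
    by (simp_all add: H_eq two_local_sum_entry pair_term_def all_less_6 qb_def idx2_def)
  have rot_13:
    "H $$ (13, 5) = H $$ (41, 40)" "H $$ (13, 9) = H $$ (19, 18)"
    using rotate[of 13 5] rotate[of 38 34] rotate[of 19 17] rotate[of 13 9] rotate[of 38 36]
    by (simp_all add: rot6_def)
  have zero_1:
    "H $$ (1, 10) = 0" "H $$ (1, 18) = 0" "H $$ (1, 34) = 0" "H $$ (1, 20) = 0"
    "H $$ (1, 36) = 0" "H $$ (1, 40) = 0"
    by (simp_all add: H_eq two_local_sum_entry pair_term_def all_less_6 qb_def idx2_def)
  have rot_1:
    "H $$ (5, 1) = H $$ (17, 16)" "H $$ (9, 1) = H $$ (9, 8)" "H $$ (17, 1) = H $$ (5, 4)"
    using rotate[of 5 1] rotate[of 34 32] rotate[of 9 1] rotate[of 36 32] rotate[of 18 16]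
      rotate[of 17 1] rotate[of 40 32] rotate[of 20 16] rotate[of 10 8]
    by (simp_all add: rot6_def)
  \<comment> \<open>Two-locality: flipping qubit 1 couples to each other qubit separately.\<close>
  have affine:
    "H $$ (35, 34) = H $$ (3, 2) + H $$ (33, 32) - H $$ (1, 0)"
    "H $$ (21, 20) = H $$ (5, 4) + H $$ (17, 16) - H $$ (1, 0)"
    "H $$ (37, 36) = H $$ (5, 4) + H $$ (33, 32) - H $$ (1, 0)"
    "H $$ (11, 10) = H $$ (3, 2) + H $$ (9, 8) - H $$ (1, 0)"
    "H $$ (41, 40) = H $$ (9, 8) + H $$ (33, 32) - H $$ (1, 0)"
    "H $$ (19, 18) = H $$ (3, 2) + H $$ (17, 16) - H $$ (1, 0)"
    by (simp_all add: H_eq two_local_sum_entry pair_term_def all_less_6 qb_def idx2_def)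
  have "H $$ (3, 2) + H $$ (33, 32) = H $$ (1, 0)"
    using row_eq[of 7] by (simp add: zero_7 rot_7 affine)
  moreover have "H $$ (21, 20) = 0"
    using row_eq[of 21] by (simp add: zero_21 rot_21)
  then have "H $$ (5, 4) + H $$ (17, 16) = H $$ (1, 0)"
    by (simp add: affine)
  moreover have "H $$ (33, 32) + H $$ (5, 4) + H $$ (3, 2) + H $$ (9, 8) = 2 * H $$ (1, 0)"
    using row_eq[of 11] by (simp add: zero_11 rot_11 affine algebra_simps)
  moreover have "H $$ (33, 32) + H $$ (17, 16) + H $$ (3, 2) + H $$ (9, 8) = 2 * H $$ (1, 0)"
    using row_eq[of 13] by (simp add: zero_13 rot_13 affine algebra_simps)
  \<comment> \<open>Row 1 empties a qubit of the pair states 5, 9, 17; by hermiticity these entries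
    are conjugates of creation amplitudes.\<close>
  moreover have "3 * H $$ (1, 0) + cnj (H $$ (17, 16) + H $$ (9, 8) + H $$ (5, 4)) = 0"
    using row_eq[of 1]
    by (simp add: zero_1 entry_cnj[of 1 5] entry_cnj[of 1 9] entry_cnj[of 1 17] rot_1 add.assoc
        del: One_nat_def)
  ultimately have "H $$ (1, 0) = 0"
    by (rule odd_rows_trivial)
  then show ?thesis
    using assms orbit by auto
qed

text \<open>By hermiticity the entries of row 0 at pair states are conjugates of the vanishing pair
  creation amplitudes.\<close>

lemma vacuum_diagonal: "H $$ (0, 0) = lam"
  using row_eq[of 0]
  by (simp add: pair_creation_eq_0
    entry_cnj[of 0 5] entry_cnj[of 0 9] entry_cnj[of 0 17] entry_cnj[of 0 10] entry_cnj[of 0 18]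
    entry_cnj[of 0 34] entry_cnj[of 0 20] entry_cnj[of 0 36] entry_cnj[of 0 40])

text \<open>The excluded indices are the 22 states of weight at most 2; one two-qubit term cannot
  take the vacuum further.\<close>

lemma multiple_creation_eq_0:
  assumes k: "k < 64"
    and many: "k \<notin> {0, 1,2,4,8,16,32, 3,6,12,24,48,33, 5,10,20,40,17,34, 9,18,36}"
  shows "H $$ (k, 0) = 0"
proof -
  have "pair_term h k 0 i j = 0" if ij: "i < j" "j < 6" for i j
  proof (rule ccontr)
    assume "pair_term h k 0 i j \<noteq> 0"
    then have "\<forall>q<6. q \<noteq> i \<and> q \<noteq> j \<longrightarrow> \<not> qb q k"
      by (auto simp: pair_term_def qb_def split: if_splits)
    from eq_if_qb_supported_on_pair[OF k ij this]
    have "k \<in> {0, 2 ^ i, 2 ^ j, 2 ^ i + 2 ^ j}"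
      by (cases "qb i k"; cases "qb j k") auto
    moreover have "(i, j) \<in> {(i, j). i < j \<and> j < 6}"
      using ij by simp
    ultimately show False
      using many unfolding ordered_pairs_6 by auto
  qed
  then show ?thesis
    unfolding H_eq two_local_sum_eq_sum_pair_term[OF k, of 0, simplified]
    by (intro sum.neutral) auto
qed

lemma vacuum_eigenvector: "H *\<^sub>v unit_vec 64 0 = lam \<cdot>\<^sub>v unit_vec 64 0"
proof (rule eq_vecI)
  fix k assume "k < dim_vec (lam \<cdot>\<^sub>v unit_vec 64 0)"
  then have k: "k < 64" by simp
  have "H $$ (k, 0) = (if k = 0 then lam else 0)"
    using vacuum_diagonal single_creation_eq_0[of k] pair_creation_eq_0[of k]
      multiple_creation_eq_0[OF k] by auto
  then show "(H *\<^sub>v unit_vec 64 0) $ k = (lam \<cdot>\<^sub>v unit_vec 64 0) $ k"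
    using k carrier by (simp add: scalar_prod_right_unit)
qed (use carrier in simp)

end

section \<open>Contradiction with uniqueness\<close>

theorem mainTheorem8:
  shows "\<not> (\<exists>H h. H \<in> carrier_mat 64 64 \<and> hermitian_mat H \<and>
            (\<forall>i j. h i j \<in> carrier_mat 4 4) \<and> H = two_local_sum h \<and>
            (\<forall>G\<in>G6. mat_adjoint G * H * G = H) \<and>
            unique_ground_state H psi6)"
proof (rule notI, elim exE conjE)
  fix H h
  assume H: "H \<in> carrier_mat 64 64" and herm: "hermitian_mat H" and loc: "H = two_local_sum h"
    and inv: "\<forall>G\<in>G6. mat_adjoint G * H * G = H" and ugs: "unique_ground_state H psi6"
  from ugs obtain lam where
    space: "{v \<in> carrier_vec (dim_row H). H *\<^sub>v v = lam \<cdot>\<^sub>v v} = {c \<cdot>\<^sub>v psi6 | c. True}"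
    unfolding unique_ground_state_def by blast
  have "psi6 \<in> {c \<cdot>\<^sub>v psi6 | c. True}"
    by (auto intro!: exI[of _ 1])
  then have eigen: "H *\<^sub>v psi6 = lam \<cdot>\<^sub>v psi6"
    unfolding space[symmetric] by blast
  have "Pc * 1\<^sub>m 64 \<in> G6"
    by (intro G6.intros)
  moreover have "Pc * 1\<^sub>m 64 = Pc"
    by (rule right_mult_one_mat[of _ 64]) (simp add: Pc_def)
  ultimately have "mat_adjoint Pc * H * Pc = H"
    using inv by metis
  then have rotate: "H $$ (k, l) = H $$ (rot6 k, rot6 l)" if "k < 64" "l < 64" for k l
    using Pc_conjugate_entry[OF H that] by simp
  interpret cyclic_two_local_psi6 H h lam
    using loc herm rotate eigen by unfold_locales (simp_all add: hermitian_mat_def)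
  have "unit_vec 64 0 \<in> {v \<in> carrier_vec (dim_row H). H *\<^sub>v v = lam \<cdot>\<^sub>v v}"
    using vacuum_eigenvector H by simp
  then obtain c where c: "unit_vec 64 0 = c \<cdot>\<^sub>v psi6"
    unfolding space by blast
  \<comment> \<open>Component 0 forces \<open>c\<close> to be nonzero, while component 5, the state
    of the pair 1, 3, forces \<open>c = 0\<close>.\<close>
  from arg_cong[OF c, of "\<lambda>v. v $ 0"] arg_cong[OF c, of "\<lambda>v. v $ 5"] show False
    by (simp add: psi6_eq)
qed

end
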